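(* Let $G=(V,E)$ be a finite simple undirected unweighted graph without isolated vertices whose optimal maxcut value is $h_{\max}(G)=1-\varepsilon$ (so $\varepsilon\in[0,\tfrac12]$). If the recursive spectral cut algorithm OPT-RSC or the algorithm $\widehat{\mathrm{OPT}}$-RSC is run on $G$, then each of the two algorithms outputs a bipartition of $V$ that cuts at least a $\left(1-\varepsilon+\varepsilon\ln(2\varepsilon)\right)$ fraction of the edges of $G$ (with the convention $0\ln 0=0$).
   Context: For a graph $H$ with vertex set $W$, at least one edge, and volume function $\mathrm{vol}_H(S)=\sum_{i\in S}\deg_H(i)$, $E_H(A,B)$ denotes the set of edges of $H$ with one endpoint in $A$ and the other in $B$, and $h_{\max}(H)=\max_{A\subset W}\dfrac{2|E_H(A,W\setminus A)|}{\mathrm{vol}_H(W)}$, i.e. the maximal fraction of edges cut by a bipartition. For disjoint $L,R\subset W$ with $\mathrm{vol}_H(L\cup R)>0$ put $U=W\setminus(L\cup R)$ and $$r_H(L,R)=\frac{2|E_H(L,R)|}{\mathrm{vol}_H(L\cup R)},\qquad \widehat r_H(L,R)=\frac{2|E_H(L,R)|+|E_H(L\cup R,U)|}{\mathrm{vol}_H(L\cup R)+|E_H(L\cup R,U)|}.$$ The maxima of $r_H$ and $\widehat r_H$ over all such pairs are the dual Cheeger constant $h^+(H)$ and the modified dual Cheeger constant $\widehat h^+(H)$. Recursive spectral cut (RSC) algorithm: set $G_1=G$, $V_1=V$. At iteration $t$, with residual graph $G_t=(V_t,E_t)$ having at least one edge, take a pair $(L_t,R_t)$ of disjoint subsets of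 $V_t$ that maximizes $r_{G_t}$ (in OPT-RSC) or maximizes $\widehat r_{G_t}$ (in $\widehat{\mathrm{OPT}}$-RSC), and let $V_{t+1}=V_t\setminus(L_t\cup R_t)$. If $\widehat r_{G_t}(L_t,R_t)>\frac12$, continue with the induced subgraph $G_{t+1}=G_t[V_{t+1}]$; otherwise replace $(L_t,R_t)$ by a bipartition of $V_t$ cutting at least half of the edges $E_t$ (found by a greedy algorithm) and terminate. The recursion also stops when the residual graph has no edges, the remaining vertices then being placed arbitrarily. The pairs $(L_1,R_1),\dots,(L_N,R_N)$ are combined greedily, from the last to the first: given the bipartition $(A,B)$ already constructed on $V_{t+1}$, the bipartition on $V_t$ is whichever of $(A\cup L_t,B\cup R_t)$ and $(A\cup R_t,B\cup L_t)$ cuts more edges of $G_t$ (so that at least half of the edges between $L_t\cup R_t$ and $V_{t+1}$ are cut). The output is the resulting bipartition of $V$. *)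

theory Defs
  imports Complex_Main
begin

text \<open>A finite simple undirected graph is given by its vertex set \<open>W\<close> and its set \<open>F\<close> of edges,
  each edge being a two-element subset of \<open>W\<close>.\<close>

definition simple_graph :: "'a set \<Rightarrow> 'a set set \<Rightarrow> bool" where
  "simple_graph W F \<longleftrightarrow> finite W \<and> (\<forall>e\<in>F. e \<subseteq> W \<and> card e = 2)"

definition deg :: "'a set set \<Rightarrow> 'a \<Rightarrow> nat" where
  "deg F v = card {e \<in> F. v \<in> e}"

definition vol :: "'a set set \<Rightarrow> 'a set \<Rightarrow> nat" where
  "vol F S = (\<Sum>i\<in>S. deg F i)"

definition edges_between :: "'a set set \<Rightarrow> 'a set \<Rightarrow> 'a set \<Rightarrow> 'a set set" where
  "edges_between F A B = {e \<in> F. \<exists>a\<in>A. \<exists>b\<in>B. e = {a, b}}"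

definition induced_edges :: "'a set set \<Rightarrow> 'a set \<Rightarrow> 'a set set" where
  "induced_edges F S = {e \<in> F. e \<subseteq> S}"

definition bipartition :: "'a set \<Rightarrow> 'a set \<Rightarrow> 'a set \<Rightarrow> bool" where
  "bipartition W A B \<longleftrightarrow> A \<union> B = W \<and> A \<inter> B = {}"

definition h_max :: "'a set \<Rightarrow> 'a set set \<Rightarrow> real" where
  "h_max W F = Max ((\<lambda>A. 2 * real (card (edges_between F A (W - A))) / real (vol F W)) ` Pow W)"

definition admissible :: "'a set \<Rightarrow> 'a set set \<Rightarrow> 'a set \<Rightarrow> 'a set \<Rightarrow> bool" where
  "admissible W F L R \<longleftrightarrow> L \<subseteq> W \<and> R \<subseteq> W \<and> L \<inter> R = {} \<and> vol F (L \<union> R) > 0"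

text \<open>The ratios \<open>r\<close> and \<open>r_hat\<close>, whose maxima over the admissible pairs are the dual Cheeger constant
  and the modified dual Cheeger constant.  The vertex set is a parameter of \<open>r\<close>, on which \<open>r\<close> does
  not depend, only so that both ratios can be passed to the algorithm below.\<close>

definition ratio :: "'a set \<Rightarrow> 'a set set \<Rightarrow> 'a set \<Rightarrow> 'a set \<Rightarrow> real" where
  "ratio W F L R = 2 * real (card (edges_between F L R)) / real (vol F (L \<union> R))"

definition ratio_hat :: "'a set \<Rightarrow> 'a set set \<Rightarrow> 'a set \<Rightarrow> 'a set \<Rightarrow> real" where
  "ratio_hat W F L R =
    (let x = real (card (edges_between F (L \<union> R) (W - (L \<union> R))))
     in (2 * real (card (edges_between F L R)) + x) / (real (vol F (L \<union> R)) + x))"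

definition maximizing_pair ::
  "('a set \<Rightarrow> 'a set set \<Rightarrow> 'a set \<Rightarrow> 'a set \<Rightarrow> real) \<Rightarrow> 'a set \<Rightarrow> 'a set set \<Rightarrow> 'a set \<Rightarrow> 'a set \<Rightarrow> bool"
where
  "maximizing_pair \<rho> W F L R \<longleftrightarrow>
    is_arg_max (\<lambda>(S, T). \<rho> W F S T) (\<lambda>(S, T). admissible W F S T) (L, R)"

text \<open>\<open>rsc \<rho> W F A B\<close>: the recursive spectral cut algorithm selecting pairs that maximize \<open>\<rho>\<close>, run
  on the graph \<open>(W, F)\<close>, may output the bipartition \<open>(A, B)\<close>.  It is a relation because the choice
  of the maximizing pair, the half cut in the terminating step, the placement of the vertices of an
  edgeless residual graph and the resolution of ties in the greedy combination are left open.
  The recursion on the residual graph constructs the bipartition from the last pair to the first.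
  The stopping test uses \<open>ratio_hat\<close> whichever \<open>\<rho>\<close> is maximized.\<close>

inductive rsc ::
  "('a set \<Rightarrow> 'a set set \<Rightarrow> 'a set \<Rightarrow> 'a set \<Rightarrow> real) \<Rightarrow> 'a set \<Rightarrow> 'a set set \<Rightarrow> 'a set \<Rightarrow> 'a set \<Rightarrow> bool"
  for \<rho>
where
  edgeless:
    "F = {} \<Longrightarrow> bipartition W A B \<Longrightarrow> rsc \<rho> W F A B"
| half_cut:
    "F \<noteq> {} \<Longrightarrow> maximizing_pair \<rho> W F L R \<Longrightarrow> ratio_hat W F L R \<le> 1 / 2 \<Longrightarrow>
     bipartition W A B \<Longrightarrow> real (card (edges_between F A B)) \<ge> real (card F) / 2 \<Longrightarrow>
     rsc \<rho> W F A B"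
| recurse:
    "F \<noteq> {} \<Longrightarrow> maximizing_pair \<rho> W F L R \<Longrightarrow> ratio_hat W F L R > 1 / 2 \<Longrightarrow>
     W' = W - (L \<union> R) \<Longrightarrow> rsc \<rho> W' (induced_edges F W') A' B' \<Longrightarrow>
     (A = A' \<union> L \<and> B = B' \<union> R) \<or> (A = A' \<union> R \<and> B = B' \<union> L) \<Longrightarrow>
     card (edges_between F A B) \<ge> card (edges_between F (A' \<union> L) (B' \<union> R)) \<Longrightarrow>
     card (edges_between F A B) \<ge> card (edges_between F (A' \<union> R) (B' \<union> L)) \<Longrightarrow>
     rsc \<rho> W F A B"

abbreviation opt_rsc :: "'a set \<Rightarrow> 'a set set \<Rightarrow> 'a set \<Rightarrow> 'a set \<Rightarrow> bool" where
  "opt_rsc \<equiv> rsc ratio"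

abbreviation opt_hat_rsc :: "'a set \<Rightarrow> 'a set set \<Rightarrow> 'a set \<Rightarrow> 'a set \<Rightarrow> bool" where
  "opt_hat_rsc \<equiv> rsc ratio_hat"

end

theory Submission
  imports Defs
begin

text \<open>The proof bounds, in every iteration, the number of cut edges against the number of edges that
  leave the residual graph.  Let \<open>u = \<epsilon> |E|\<close> be the number of edges that an optimal bipartition of
  \<open>G\<close> leaves uncut.  Its restriction to a residual graph with \<open>s\<close> edges still leaves at most \<open>u\<close>
  edges uncut, so it is an admissible pair of ratio at least \<open>1 - u / s\<close>; for a bipartition the two
  ratios agree.  As \<open>r \<le> r_hat\<close> always, the chosen pair has \<open>r_hat \<ge> 1 - u / s\<close> in both variants of
  the algorithm (\<open>ratio_hat_maximizing_pair_ge\<close>).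

  What makes \<open>r_hat\<close> the right quantity is the greedy combination: if \<open>e\<close> edges touch \<open>L \<union> R\<close>, then
  the better of the two orientations cuts at least \<open>r_hat e\<close> of them, namely all edges between \<open>L\<close>
  and \<open>R\<close> and half of those leaving \<open>L \<union> R\<close> (\<open>combination_gain\<close>).  An iteration that reduces the
  number of edges from \<open>s\<close> to \<open>s'\<close> therefore cuts at least \<open>(s - s') max (1/2) (1 - u / s)\<close> edges,
  and this is at least the integral of the increasing function \<open>max (1/2) (1 - u / y)\<close> over
  \<open>y \<in> [s', s]\<close>.  When the algorithm stops with a half cut, \<open>1 - u / s \<le> 1/2\<close>, and the half cut
  achieves the whole remaining integral.  Summing up, at least the integral over \<open>[0, |E|]\<close> many edges
  are cut (\<open>rsc_cut_ge\<close>), and this integral is \<open>(1 - \<epsilon> + \<epsilon> ln (2 \<epsilon>)) |E|\<close>.\<close>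

section \<open>Counting edges\<close>

lemma simple_graph_finite_edges:
  assumes "simple_graph W F"
  shows "finite F"
proof -
  have "F \<subseteq> Pow W" "finite W" using assms by (auto simp: simple_graph_def)
  then show ?thesis by (meson finite_Pow_iff finite_subset)
qed

lemma simple_graph_induced:
  assumes "simple_graph W F" "W' \<subseteq> W"
  shows "simple_graph W' (induced_edges F W')"
  using assms by (auto simp: simple_graph_def induced_edges_def intro: finite_subset)

lemma simple_graph_edgeE:
  assumes "simple_graph W F" "e \<in> F"
  obtains a b where "e = {a, b}" "a \<noteq> b" "a \<in> W" "b \<in> W"
proof -
  have "card e = 2" "e \<subseteq> W" using assms by (auto simp: simple_graph_def)
  then show ?thesis using that by (auto simp: card_2_iff)
qed

lemma edges_between_commute: "edges_between F A B = edges_between F B A"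
  unfolding edges_between_def by (metis insert_commute)

lemma edges_between_subset: "edges_between F A B \<subseteq> F"
  by (auto simp: edges_between_def)

lemma card_edges_between_Un:
  assumes "finite F" "A \<inter> C = {}" "A \<inter> B = {}" "C \<inter> B = {}"
  shows "card (edges_between F (A \<union> C) B) = card (edges_between F A B) + card (edges_between F C B)"
proof -
  have "edges_between F (A \<union> C) B = edges_between F A B \<union> edges_between F C B"
    by (auto simp: edges_between_def)
  moreover have "edges_between F A B \<inter> edges_between F C B = {}"
    using assms by (auto simp: edges_between_def doubleton_eq_iff)
  moreover have "finite (edges_between F A B)" "finite (edges_between F C B)"
    using assms edges_between_subset finite_subset by metis+
  ultimately show ?thesis by (simp add: card_Un_disjoint)
qed

lemma edges_between_induced:
  assumes "A \<subseteq> W'" "B \<subseteq> W'"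
  shows "edges_between (induced_edges F W') A B = edges_between F A B"
  using assms by (auto simp: edges_between_def induced_edges_def)

lemma sum_indicator_card:
  assumes "finite F" "G \<subseteq> F"
  shows "(\<Sum>e\<in>F. if e \<in> G then k else 0) = k * card G"
proof -
  have "F \<inter> G = G" using assms by blast
  then show ?thesis using assms by (simp add: sum.If_cases)
qed

lemma vol_eq_sum_edges:
  assumes "simple_graph W F" "S \<subseteq> W"
  shows "vol F S = (\<Sum>e\<in>F. card (e \<inter> S))"
proof -
  have fin: "finite F" "finite S"
    using assms simple_graph_finite_edges by (auto simp: simple_graph_def intro: finite_subset)
  have "vol F S = (\<Sum>v\<in>S. \<Sum>e\<in>F. if v \<in> e then 1 else 0)"
    using fin by (simp add: vol_def deg_def sum.If_cases Int_def)
  also have "\<dots> = (\<Sum>e\<in>F. \<Sum>v\<in>S. if v \<in> e then 1 else 0)"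
    by (rule sum.swap)
  also have "\<dots> = (\<Sum>e\<in>F. card (e \<inter> S))"
    using fin by (simp add: sum.If_cases Int_def conj_commute)
  finally show ?thesis .
qed

text \<open>Both sides count every edge twice: the volume counts an edge inside \<open>S\<close> twice, but an edge
  leaving \<open>S\<close> only once.\<close>

lemma vol_plus_boundary:
  assumes "simple_graph W F" "S \<subseteq> W"
  shows "vol F S + card (edges_between F S (W - S)) + 2 * card (induced_edges F (W - S)) = 2 * card F"
proof -
  have fin: "finite F" using assms simple_graph_finite_edges by blast
  let ?b = "\<lambda>e. if e \<in> edges_between F S (W - S) then 1 else (0::nat)"
  let ?i = "\<lambda>e. if e \<in> induced_edges F (W - S) then 2 else (0::nat)"
  have edge: "card (e \<inter> S) + ?b e + ?i e = 2" if e: "e \<in> F" for e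
  proof -
    obtain a b where ab: "e = {a, b}" "a \<noteq> b" "a \<in> W" "b \<in> W"
      using simple_graph_edgeE[OF assms(1) e] .
    show ?thesis
      using ab e assms(2)
      by (cases "a \<in> S"; cases "b \<in> S")
         (auto simp: edges_between_def induced_edges_def doubleton_eq_iff)
  qed
  have "2 * card F = (\<Sum>e\<in>F. card (e \<inter> S) + ?b e + ?i e)"
    by (simp add: edge cong: sum.cong)
  also have "\<dots> = vol F S + card (edges_between F S (W - S)) + 2 * card (induced_edges F (W - S))"
    using sum_indicator_card[where k = 1 and G = "edges_between F S (W - S)", OF fin edges_between_subset]
      sum_indicator_card[OF fin, where k = 2 and G = "induced_edges F (W - S)"]
    by (simp add: sum.distrib vol_eq_sum_edges[OF assms] induced_edges_def)
  finally show ?thesis by simp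
qed

lemma vol_all_vertices:
  assumes "simple_graph W F"
  shows "vol F W = 2 * card F"
proof -
  have "edges_between F W (W - W) = {}" "induced_edges F (W - W) = {}"
    using assms by (auto simp: edges_between_def induced_edges_def simple_graph_def)
  then show ?thesis using vol_plus_boundary[OF assms, of W] by simp
qed

lemma edges_between_le_vol:
  assumes "simple_graph W F" "L \<subseteq> W" "R \<subseteq> W" "L \<inter> R = {}"
  shows "2 * card (edges_between F L R) \<le> vol F (L \<union> R)"
proof -
  have fin: "finite F" using assms simple_graph_finite_edges by blast
  have "2 * card (edges_between F L R) = (\<Sum>e\<in>F. if e \<in> edges_between F L R then 2 else 0)"
    using sum_indicator_card[OF fin edges_between_subset] by metis
  also have "\<dots> \<le> (\<Sum>e\<in>F. card (e \<inter> (L \<union> R)))"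
  proof (rule sum_mono)
    fix e assume "e \<in> F"
    show "(if e \<in> edges_between F L R then 2 else 0) \<le> card (e \<inter> (L \<union> R))"
    proof (cases "e \<in> edges_between F L R")
      case True
      then obtain a b where "e = {a, b}" "a \<in> L" "b \<in> R" by (auto simp: edges_between_def)
      moreover from this have "a \<noteq> b" "e \<inter> (L \<union> R) = {a, b}" using assms(4) by auto
      ultimately show ?thesis by simp
    qed simp
  qed
  also have "\<dots> = vol F (L \<union> R)" using assms by (simp add: vol_eq_sum_edges)
  finally show ?thesis .
qed

section \<open>The greedy combination\<close>

text \<open>Every edge between \<open>L\<close> and \<open>R\<close> is cut by both orientations, and every edge leaving \<open>L \<union> R\<close> is
  cut by exactly one of them.\<close>

lemma combination_sum:
  assumes "finite F" "L \<inter> R = {}" "bipartition (W - (L \<union> R)) A B"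
  shows "card (edges_between F (A \<union> L) (B \<union> R)) + card (edges_between F (A \<union> R) (B \<union> L))
    = 2 * card (edges_between F A B) + 2 * card (edges_between F L R)
      + card (edges_between F (L \<union> R) (W - (L \<union> R)))"
proof -
  have disj: "A \<inter> B = {}" "A \<inter> L = {}" "A \<inter> R = {}" "B \<inter> L = {}" "B \<inter> R = {}"
    using assms(3) by (auto simp: bipartition_def)
  have rest: "W - (L \<union> R) = A \<union> B" using assms(3) by (auto simp: bipartition_def)
  note left = card_edges_between_Un[OF assms(1)]
  have right: "card (edges_between F S (P \<union> Q)) = card (edges_between F S P) + card (edges_between F S Q)"
    if "P \<inter> Q = {}" "P \<inter> S = {}" "Q \<inter> S = {}" for S P Q
    using left[OF that] by (simp add: edges_between_commute)
  have "card (edges_between F (A \<union> L) (B \<union> R))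
    = card (edges_between F A B) + card (edges_between F A R)
      + card (edges_between F L B) + card (edges_between F L R)"
    using disj assms(2) by (subst left; (subst right)?; (subst right)?; auto)
  moreover have "card (edges_between F (A \<union> R) (B \<union> L))
    = card (edges_between F A B) + card (edges_between F A L)
      + card (edges_between F R B) + card (edges_between F R L)"
    using disj assms(2) by (subst left; (subst right)?; (subst right)?; auto)
  moreover have "card (edges_between F (L \<union> R) (A \<union> B))
    = card (edges_between F L A) + card (edges_between F L B)
      + card (edges_between F R A) + card (edges_between F R B)"
    using disj assms(2) by (subst left; (subst right)?; (subst right)?; auto)
  ultimately show ?thesis
    unfolding rest
    by (simp add: edges_between_commute[of F A L] edges_between_commute[of F A R]
        edges_between_commute[of F R L])
qed

text \<open>The number of edges touching \<open>L \<union> R\<close> is half the denominator of \<open>r_hat\<close>, and by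
  \<open>combination_sum\<close> the better orientation cuts at least half the numerator of them.\<close>

lemma combination_gain:
  assumes "simple_graph W F" "admissible W F L R" "W' = W - (L \<union> R)" "bipartition W' A' B'"
    and "card (edges_between F A B) \<ge> card (edges_between F (A' \<union> L) (B' \<union> R))"
    and "card (edges_between F A B) \<ge> card (edges_between F (A' \<union> R) (B' \<union> L))"
  shows "real (card (edges_between F A B)) \<ge> real (card (edges_between (induced_edges F W') A' B'))
    + ratio_hat W F L R * (real (card F) - real (card (induced_edges F W')))"
proof -
  define x where "x = card (edges_between F (L \<union> R) W')"
  have adm: "L \<inter> R = {}" "L \<union> R \<subseteq> W" "vol F (L \<union> R) > 0"
    using assms(2) by (auto simp: admissible_def)
  have fin: "finite F" using assms(1) by (rule simple_graph_finite_edges)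
  have "A' \<subseteq> W'" "B' \<subseteq> W'" using assms(4) by (auto simp: bipartition_def)
  then have ind: "edges_between (induced_edges F W') A' B' = edges_between F A' B'"
    by (rule edges_between_induced)
  have "vol F (L \<union> R) + x + 2 * card (induced_edges F W') = 2 * card F"
    using vol_plus_boundary[OF assms(1) adm(2)] by (simp add: x_def assms(3))
  then have "real (vol F (L \<union> R) + x + 2 * card (induced_edges F W')) = real (2 * card F)"
    by simp
  then have touch: "real (vol F (L \<union> R)) + real x
      = 2 * (real (card F) - real (card (induced_edges F W')))"
    by simp
  have "2 * card (edges_between F A B)
      \<ge> 2 * card (edges_between F A' B') + 2 * card (edges_between F L R) + x"
    using combination_sum[OF fin adm(1), of W A' B'] assms(3-6) by (simp add: x_def)
  then have "real (2 * card (edges_between F A B))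
      \<ge> real (2 * card (edges_between F A' B') + 2 * card (edges_between F L R) + x)"
    by (simp only: of_nat_le_iff)
  then have "real (card (edges_between F A B))
      \<ge> real (card (edges_between F A' B')) + (2 * real (card (edges_between F L R)) + real x) / 2"
    by (simp add: field_simps)
  moreover have "ratio_hat W F L R * (real (card F) - real (card (induced_edges F W')))
      = (2 * real (card (edges_between F L R)) + real x) / 2"
  proof -
    have "ratio_hat W F L R
        = (2 * real (card (edges_between F L R)) + real x)
          / (2 * (real (card F) - real (card (induced_edges F W'))))"
      unfolding touch[symmetric] by (simp add: ratio_hat_def x_def assms(3) Let_def)
    moreover have "real (card F) - real (card (induced_edges F W')) > 0"
      using touch adm(3) by simp
    ultimately show ?thesis by (simp add: field_simps)
  qed
  ultimately show ?thesis by (simp only: ind)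
qed

text \<open>Adding the vertices one at a time, each on its better side, is the greedy combination for the
  pairs \<open>({v}, {})\<close>.\<close>

lemma half_cut_exists:
  assumes "simple_graph W F"
  shows "\<exists>A B. bipartition W A B \<and> real (card (edges_between F A B)) \<ge> real (card F) / 2"
proof -
  have "finite W" using assms by (simp add: simple_graph_def)
  then show ?thesis using assms
  proof (induction W arbitrary: F rule: finite_induct)
    case empty
    then have "F = {}" by (auto simp: simple_graph_def)
    then show ?case by (auto simp: bipartition_def)
  next
    case (insert v W)
    let ?F = "induced_edges F W"
    have fin: "finite F" using insert.prems by (rule simple_graph_finite_edges)
    have W: "W = insert v W - ({v} \<union> {})" using insert.hyps by auto
    have "simple_graph W ?F" using insert.prems by (rule simple_graph_induced) auto
    then obtain A B where AB: "bipartition W A B"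
        "real (card (edges_between ?F A B)) \<ge> real (card ?F) / 2"
      using insert.IH by blast
    have ind: "edges_between ?F A B = edges_between F A B"
      using AB(1) by (intro edges_between_induced) (auto simp: bipartition_def)
    have no_edges: "edges_between F {v} {} = {}" by (auto simp: edges_between_def)
    \<comment> \<open>As \<open>v\<close> has no loop, every edge at \<open>v\<close> leaves \<open>{v}\<close>.\<close>
    have "vol F {v} = card (edges_between F {v} W)"
    proof -
      have "{e \<in> F. v \<in> e} = edges_between F {v} W"
      proof (intro equalityI subsetI)
        fix e assume "e \<in> {e \<in> F. v \<in> e}"
        then obtain a b where "e = {a, b}" "a \<noteq> b" "a \<in> insert v W" "b \<in> insert v W" "v \<in> {a, b}" "e \<in> F"
          using simple_graph_edgeE[OF insert.prems] by (metis (mono_tags, lifting) mem_Collect_eq)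
        then show "e \<in> edges_between F {v} W" by (auto simp: edges_between_def)
      qed (auto simp: edges_between_def)
      then show ?thesis by (simp add: vol_def deg_def)
    qed
    then have "card (edges_between F {v} W) + card ?F = card F"
      using vol_plus_boundary[OF insert.prems, of "{v}"] W by simp
    then have "card (edges_between F (A \<union> {v}) B) + card (edges_between F A (B \<union> {v}))
        \<ge> 2 * card (edges_between ?F A B) + (card F - card ?F)"
      using combination_sum[OF fin, of "{v}" "{}" "insert v W" A B] AB(1) W no_edges ind by simp
    moreover have "card ?F \<le> card F"
      using fin by (auto simp: induced_edges_def intro: card_mono)
    ultimately have "real (card (edges_between F (A \<union> {v}) B)) \<ge> real (card F) / 2
        \<or> real (card (edges_between F A (B \<union> {v}))) \<ge> real (card F) / 2"
      using AB(2) by linarith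
    moreover have "bipartition (insert v W) (A \<union> {v}) B" "bipartition (insert v W) A (B \<union> {v})"
      using AB(1) insert.hyps by (auto simp: bipartition_def)
    ultimately show ?case by blast
  qed
qed

section \<open>Maximizing pairs\<close>

lemma admissible_bipartition:
  assumes "simple_graph W F" "F \<noteq> {}" "bipartition W A B"
  shows "admissible W F A B"
proof -
  have "card F > 0" using assms simple_graph_finite_edges card_gt_0_iff by metis
  moreover have "A \<union> B = W" "A \<inter> B = {}" using assms(3) by (auto simp: bipartition_def)
  ultimately show ?thesis using vol_all_vertices[OF assms(1)] by (auto simp: admissible_def)
qed

lemma maximizing_pair_exists:
  assumes "simple_graph W F" "F \<noteq> {}"
  shows "\<exists>L R. maximizing_pair \<rho> W F L R"
proof -
  define P where "P = {(L, R). admissible W F L R}"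
  have "P \<subseteq> Pow W \<times> Pow W" by (auto simp: P_def admissible_def)
  then have fin: "finite P"
    using assms(1) by (meson finite_Pow_iff finite_SigmaI finite_subset simple_graph_def)
  have "(W, {}) \<in> P"
    using admissible_bipartition[OF assms, of W "{}"] by (simp add: P_def bipartition_def)
  then have ne: "P \<noteq> {}" by blast
  let ?v = "\<lambda>(S, T). \<rho> W F S T"
  have "Max (?v ` P) \<in> ?v ` P" using fin ne by (intro Max_in) auto
  then obtain p where p: "p \<in> P" "?v p = Max (?v ` P)" by auto
  have "?v q \<le> ?v p" if "q \<in> P" for q
    unfolding p(2) using fin that by (intro Max_ge) auto
  then have "is_arg_max ?v (\<lambda>(S, T). admissible W F S T) p"
    using p(1) by (force simp: is_arg_max_def P_def not_less)
  then show ?thesis by (cases p) (auto simp: maximizing_pair_def)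
qed

lemma ratio_le_ratio_hat:
  assumes "simple_graph W F" "admissible W F L R"
  shows "ratio W F L R \<le> ratio_hat W F L R"
proof -
  define c v x where "c = 2 * real (card (edges_between F L R))" and "v = real (vol F (L \<union> R))"
    and "x = real (card (edges_between F (L \<union> R) (W - (L \<union> R))))"
  have "2 * card (edges_between F L R) \<le> vol F (L \<union> R)"
    using assms by (intro edges_between_le_vol) (auto simp: admissible_def)
  then have "c \<le> v" "0 < v" "0 \<le> x"
    using assms(2) by (auto simp: c_def v_def x_def admissible_def)
  moreover from this have "c * x \<le> v * x" by (simp add: mult_right_mono)
  ultimately have "c / v \<le> (c + x) / (v + x)" by (simp add: field_simps)
  then show ?thesis by (simp add: ratio_def ratio_hat_def c_def v_def x_def Let_def)
qed

text \<open>No edge leaves the vertex set, so for a bipartition both ratios are the fraction of cut edges.\<close>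

lemma ratio_bipartition:
  assumes "simple_graph W F" "bipartition W A B" "\<rho> \<in> {ratio, ratio_hat}"
  shows "\<rho> W F A B = real (card (edges_between F A B)) / real (card F)"
proof -
  have "A \<union> B = W" using assms(2) by (simp add: bipartition_def)
  moreover have "edges_between F W (W - W) = {}" by (auto simp: edges_between_def)
  ultimately show ?thesis
    using assms(3) vol_all_vertices[OF assms(1)]
    by (auto simp: ratio_def ratio_hat_def Let_def)
qed

text \<open>A bipartition with few uncut edges competes with the chosen pair.  If the pair maximizes
  \<open>ratio\<close>, the bound passes to \<open>ratio_hat\<close> by \<open>ratio_le_ratio_hat\<close>.\<close>

lemma ratio_hat_maximizing_pair_ge:
  assumes "simple_graph W F" "F \<noteq> {}" "\<rho> \<in> {ratio, ratio_hat}" "maximizing_pair \<rho> W F L R"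
    and "bipartition W A B" "real (card F) \<le> real (card (edges_between F A B)) + u"
  shows "ratio_hat W F L R \<ge> 1 - u / real (card F)"
proof -
  have pos: "real (card F) > 0"
    using assms simple_graph_finite_edges card_gt_0_iff by fastforce
  have adm: "admissible W F L R"
    using assms(4) by (simp add: maximizing_pair_def is_arg_max_def)
  have "1 - u / real (card F) \<le> real (card (edges_between F A B)) / real (card F)"
    using divide_right_mono[of "real (card F) - u" _ "real (card F)"] assms(6) pos
    by (simp add: diff_divide_distrib)
  also have "\<dots> = \<rho> W F A B"
    using ratio_bipartition assms by metis
  also have "\<dots> \<le> \<rho> W F L R"
    using assms(4) admissible_bipartition[OF assms(1,2,5)]
    by (auto simp: maximizing_pair_def is_arg_max_def not_less)
  also have "\<dots> \<le> ratio_hat W F L R"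
    using assms(3) ratio_le_ratio_hat[OF assms(1) adm] by auto
  finally show ?thesis .
qed

section \<open>The guaranteed number of cut edges\<close>

text \<open>The integral of \<open>max (1/2) (1 - u / y)\<close> over \<open>y \<in> [0, s]\<close>, in closed form; the two arguments of
  the maximum agree at \<open>y = 2 u\<close>.  For \<open>u = 0\<close> the junk value \<open>ln (s / 0)\<close> is multiplied by \<open>0\<close>.\<close>

definition cut_guarantee :: "real \<Rightarrow> real \<Rightarrow> real" where
  "cut_guarantee u s = (if s \<le> 2 * u then s / 2 else s - u - u * ln (s / (2 * u)))"

text \<open>An increasing integrand is at most its value at the right end point.  On the logarithmic
  branch this is the inequality \<open>ln y \<le> y - 1\<close>, where \<open>y\<close> is the
  quotient of the end points.\<close>

lemma cut_guarantee_diff_le: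
  assumes "0 \<le> u" "0 \<le> s" "s \<le> m" "0 < m" "1 / 2 \<le> q" "1 - u / m \<le> q"
  shows "cut_guarantee u m - cut_guarantee u s \<le> (m - s) * q"
proof (cases "m \<le> 2 * u")
  case True
  have "(m - s) * (1 / 2) \<le> (m - s) * q" using assms by (intro mult_left_mono) auto
  then show ?thesis using True assms by (simp add: cut_guarantee_def field_simps)
next
  case False
  have log: "cut_guarantee u m - (t - u - u * ln (t / (2 * u))) \<le> (m - t) * q"
    if t: "2 * u \<le> t" "0 < t" "t \<le> m" for t
  proof -
    have "u * (ln (m / (2 * u)) - ln (t / (2 * u))) = u * - ln (t / m)"
      using assms t by (cases "u = 0") (auto simp: ln_div)
    moreover have "u * (1 - t / m) \<le> u * - ln (t / m)"
      using assms t ln_le_minus_one[of "t / m"] by (intro mult_left_mono) auto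
    ultimately have "cut_guarantee u m - (t - u - u * ln (t / (2 * u))) \<le> (m - t) - u * (1 - t / m)"
      using False by (simp add: cut_guarantee_def algebra_simps)
    also have "\<dots> = (m - t) * (1 - u / m)" using assms by (simp add: field_simps)
    also have "\<dots> \<le> (m - t) * q" using assms t by (intro mult_left_mono) auto
    finally show ?thesis .
  qed
  show ?thesis
  proof (cases "2 * u < s")
    case True
    then show ?thesis using log[of s] assms by (simp add: cut_guarantee_def)
  next
    case s: False
    show ?thesis
    proof (cases "u = 0")
      case True
      then show ?thesis using s assms False by (simp add: cut_guarantee_def)
    next
      case u: False
      \<comment> \<open>The interval from \<open>s\<close> to \<open>m\<close> is split at \<open>2 u\<close>, where the branches meet.\<close>
      have "cut_guarantee u m - u \<le> (m - 2 * u) * q"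
        using log[of "2 * u"] u assms False by simp
      moreover have "(2 * u - s) * (1 / 2) \<le> (2 * u - s) * q"
        using assms s by (intro mult_left_mono) auto
      ultimately show ?thesis using s by (simp add: cut_guarantee_def algebra_simps)
    qed
  qed
qed

lemma cut_guarantee_fraction:
  assumes "0 \<le> \<epsilon>" "\<epsilon> \<le> 1 / 2" "0 < m"
  shows "cut_guarantee (\<epsilon> * m) m = (1 - \<epsilon> + \<epsilon> * ln (2 * \<epsilon>)) * m"
proof (cases "\<epsilon> = 0 \<or> \<epsilon> = 1 / 2")
  case True
  then show ?thesis using assms by (auto simp: cut_guarantee_def)
next
  case False
  then have "\<epsilon> * m < (1 / 2) * m" using assms by (intro mult_strict_right_mono) auto
  moreover have "ln (m / (2 * (\<epsilon> * m))) = - ln (2 * \<epsilon>)"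
  proof -
    have "m / (2 * (\<epsilon> * m)) = inverse (2 * \<epsilon>)" using assms by (simp add: field_simps)
    then show ?thesis by (simp only: ln_inverse)
  qed
  ultimately have "cut_guarantee (\<epsilon> * m) m = m - \<epsilon> * m - \<epsilon> * m * - ln (2 * \<epsilon>)"
    by (simp only: cut_guarantee_def) simp
  then show ?thesis by (simp add: algebra_simps)
qed

section \<open>The recursive spectral cut\<close>

lemma rsc_exists:
  assumes "simple_graph W F"
  shows "\<exists>A B. rsc \<rho> W F A B"
proof -
  have "finite W" using assms by (simp add: simple_graph_def)
  then show ?thesis using assms
  proof (induction W arbitrary: F rule: finite_psubset_induct)
    case (psubset W)
    show ?case
    proof (cases "F = {}")
      case True
      then have "rsc \<rho> W F W {}" by (intro rsc.edgeless) (auto simp: bipartition_def)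
      then show ?thesis by blast
    next
      case False
      obtain L R where max: "maximizing_pair \<rho> W F L R"
        using maximizing_pair_exists[OF psubset.prems False] by blast
      show ?thesis
      proof (cases "ratio_hat W F L R \<le> 1 / 2")
        case True
        then show ?thesis
          using rsc.half_cut[OF False max] half_cut_exists[OF psubset.prems] by blast
      next
        case gt: False
        define W' where "W' = W - (L \<union> R)"
        have "L \<union> R \<subseteq> W" "vol F (L \<union> R) > 0"
          using max by (auto simp: maximizing_pair_def is_arg_max_def admissible_def)
        moreover from this(2) have "L \<union> R \<noteq> {}" by (auto simp: vol_def)
        ultimately have "W' \<subset> W" by (auto simp: W'_def)
        then obtain A' B' where rec: "rsc \<rho> W' (induced_edges F W') A' B'"
          using psubset.IH simple_graph_induced[OF psubset.prems, of W'] by blast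
        note combine = rsc.recurse[OF False max _ W'_def rec]
        show ?thesis
        proof (cases "card (edges_between F (A' \<union> R) (B' \<union> L)) \<le> card (edges_between F (A' \<union> L) (B' \<union> R))")
          case True
          then show ?thesis using combine[of "A' \<union> L" "B' \<union> R"] gt by auto
        next
          case False
          then show ?thesis using combine[of "A' \<union> R" "B' \<union> L"] gt by auto
        qed
      qed
    qed
  qed
qed

text \<open>The number \<open>u\<close> stays the same in the recursion: the reference bipartition \<open>(A\<^sub>0, B\<^sub>0)\<close> is
  restricted to the residual vertices, which creates no new uncut edges.\<close>

lemma rsc_cut_ge:
  assumes "rsc \<rho> W F A B" "\<rho> \<in> {ratio, ratio_hat}" "0 \<le> u" "simple_graph W F"
    and "bipartition W A\<^sub>0 B\<^sub>0" "real (card F) \<le> real (card (edges_between F A\<^sub>0 B\<^sub>0)) + u"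
  shows "bipartition W A B \<and> cut_guarantee u (real (card F)) \<le> real (card (edges_between F A B))"
  using assms
proof (induction arbitrary: A\<^sub>0 B\<^sub>0 rule: rsc.induct)
  case (edgeless F W A B)
  then show ?case by (simp add: cut_guarantee_def)
next
  case (half_cut F W L R A B)
  have "1 - u / real (card F) \<le> 1 / 2"
    using ratio_hat_maximizing_pair_ge[OF _ half_cut.hyps(1) _ half_cut.hyps(2)] half_cut.hyps half_cut.prems
    by fastforce
  moreover have "real (card F) > 0"
    using half_cut simple_graph_finite_edges card_gt_0_iff by fastforce
  ultimately have "real (card F) \<le> 2 * u" by (simp add: field_simps)
  then show ?case using half_cut by (simp add: cut_guarantee_def)
next
  case (recurse F W L R W' A' B' A B)
  let ?F = "induced_edges F W'"
  have fin: "finite F" using recurse.prems simple_graph_finite_edges by blast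
  have adm: "admissible W F L R"
    using recurse.hyps(2) by (simp add: maximizing_pair_def is_arg_max_def)
  have sub: "W' \<subseteq> W" "?F \<subseteq> F" using recurse.hyps(4) by (auto simp: induced_edges_def)
  have part0: "bipartition W' (A\<^sub>0 \<inter> W') (B\<^sub>0 \<inter> W')"
    using recurse.prems(4) sub(1) by (auto simp: bipartition_def)
  have "?F - edges_between ?F (A\<^sub>0 \<inter> W') (B\<^sub>0 \<inter> W') \<subseteq> F - edges_between F A\<^sub>0 B\<^sub>0"
    by (auto simp: induced_edges_def edges_between_def)
  then have "card (?F - edges_between ?F (A\<^sub>0 \<inter> W') (B\<^sub>0 \<inter> W')) \<le> card (F - edges_between F A\<^sub>0 B\<^sub>0)"
    using fin by (intro card_mono) auto
  moreover have "card (G - edges_between G S T) + card (edges_between G S T) = card G"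
    if "finite G" for G :: "'a set set" and S T
    using that edges_between_subset[of G S T]
    by (metis card_Diff_subset card_mono finite_subset le_add_diff_inverse2)
  ultimately have uncut0: "real (card ?F) \<le> real (card (edges_between ?F (A\<^sub>0 \<inter> W') (B\<^sub>0 \<inter> W'))) + u"
    using fin sub(2) recurse.prems(5) by (smt (verit) finite_subset of_nat_add of_nat_le_iff)
  have IH: "bipartition W' A' B'" "cut_guarantee u (real (card ?F)) \<le> real (card (edges_between ?F A' B'))"
    using recurse.IH[OF recurse.prems(1,2) simple_graph_induced[OF recurse.prems(3) sub(1)] part0 uncut0]
    by auto
  have part: "bipartition W A B"
    using recurse.hyps(4,6) IH(1) adm by (auto simp: bipartition_def admissible_def)
  have "1 - u / real (card F) \<le> ratio_hat W F L R"
    using ratio_hat_maximizing_pair_ge[OF recurse.prems(3) recurse.hyps(1) recurse.prems(1) recurse.hyps(2)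
        recurse.prems(4,5)] .
  then have "cut_guarantee u (real (card F)) - cut_guarantee u (real (card ?F))
      \<le> (real (card F) - real (card ?F)) * ratio_hat W F L R"
    using recurse.hyps(1,3) recurse.prems(2) fin sub(2)
    by (intro cut_guarantee_diff_le) (auto simp: card_gt_0_iff intro: card_mono)
  moreover have "real (card (edges_between F A B)) \<ge> real (card (edges_between ?F A' B'))
      + ratio_hat W F L R * (real (card F) - real (card ?F))"
    using combination_gain[OF recurse.prems(3) adm recurse.hyps(4) IH(1) recurse.hyps(7,8)] .
  ultimately show ?case using part IH(2) by (simp add: mult.commute)
qed

theorem theorem4p1:
  fixes V :: "'a set" and E :: "'a set set" and \<epsilon> :: real
  assumes "simple_graph V E"
    and "E \<noteq> {}"
    and "\<forall>v\<in>V. deg E v > 0"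
    and "h_max V E = 1 - \<epsilon>"
  shows "0 \<le> \<epsilon> \<and> \<epsilon> \<le> 1 / 2 \<and>
    (\<exists>A B. opt_rsc V E A B) \<and>
    (\<forall>A B. opt_rsc V E A B \<longrightarrow> bipartition V A B \<and>
       real (card (edges_between E A B)) / real (card E) \<ge> 1 - \<epsilon> + \<epsilon> * ln (2 * \<epsilon>)) \<and>
    (\<exists>A B. opt_hat_rsc V E A B) \<and>
    (\<forall>A B. opt_hat_rsc V E A B \<longrightarrow> bipartition V A B \<and>
       real (card (edges_between E A B)) / real (card E) \<ge> 1 - \<epsilon> + \<epsilon> * ln (2 * \<epsilon>))"
proof -
  define m where "m = real (card E)"
  have fin: "finite E" "finite V"
    using assms(1) simple_graph_finite_edges by (auto simp: simple_graph_def)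
  have pos: "m > 0" using fin assms(2) by (simp add: m_def card_gt_0_iff)
  let ?frac = "\<lambda>A. real (card (edges_between E A (V - A))) / m"
  have h: "h_max V E = Max (?frac ` Pow V)"
    by (simp add: h_max_def vol_all_vertices[OF assms(1)] m_def)
  have "h_max V E \<in> ?frac ` Pow V" unfolding h using fin by (intro Max_in) auto
  then obtain A\<^sub>0 where A0: "A\<^sub>0 \<subseteq> V" "?frac A\<^sub>0 = 1 - \<epsilon>" using assms(4) by auto
  have "card (edges_between E A\<^sub>0 (V - A\<^sub>0)) \<le> card E"
    using fin by (intro card_mono edges_between_subset)
  then have "?frac A\<^sub>0 \<le> 1" using pos by (simp add: m_def)
  then have eps0: "0 \<le> \<epsilon>" using A0(2) by linarith
  obtain A B where AB: "bipartition V A B" "real (card (edges_between E A B)) \<ge> m / 2"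
    using half_cut_exists[OF assms(1)] by (auto simp: m_def)
  then have "B = V - A" "A \<subseteq> V" by (auto simp: bipartition_def)
  then have "?frac A \<le> h_max V E" "1 / 2 \<le> ?frac A"
    using fin pos AB(2) by (auto simp: h field_simps)
  then have eps1: "\<epsilon> \<le> 1 / 2" using assms(4) by linarith
  have part0: "bipartition V A\<^sub>0 (V - A\<^sub>0)" using A0(1) by (auto simp: bipartition_def)
  have uncut0: "real (card E) \<le> real (card (edges_between E A\<^sub>0 (V - A\<^sub>0))) + \<epsilon> * m"
    using A0(2) pos by (simp add: m_def field_simps)
  have "bipartition V A B \<and>
      real (card (edges_between E A B)) / real (card E) \<ge> 1 - \<epsilon> + \<epsilon> * ln (2 * \<epsilon>)"
    if "rsc \<rho> V E A B" "\<rho> \<in> {ratio, ratio_hat}" for \<rho> A B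
    using rsc_cut_ge[OF that _ assms(1) part0 uncut0] eps0 pos cut_guarantee_fraction[OF eps0 eps1 pos]
    by (simp add: m_def le_divide_eq)
  then show ?thesis using eps0 eps1 rsc_exists[OF assms(1)] by blast
qed

end
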